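(* Let $m\ge p$ and $n\ge p$, and for estimators of $\Sigma$ of the form described in the context let $\widehat\Delta(\cdot,\widehat\Sigma_0)$ be the unbiased estimator of the risk difference given there, regarded as a function of $f_1>\cdots>f_p>0$. (1) For $0<\alpha<1$ and $\beta\ge0$ let $$\widehat\Sigma^{G2}=\widehat\Sigma_0-\alpha\widehat\Sigma_0(I_p+\beta S^{-1}X^\top X)^{-1},\qquad \widehat\Sigma_0=n^{-1}S,$$ which corresponds to $\psi_i=\alpha/(1+\beta f_i)$. There is no such estimator $\widehat\Sigma^{G2}$ for which $\widehat\Delta(\widehat\Sigma^{G2},\widehat\Sigma_0)\le0$ for all $f_1>\cdots>f_p>0$. (2) Let $c=n-m-1$ with $p-m-2<c<a+p$, and put $k_0=(a+m+2p-n)/(a+m+2p)$. The generalized Bayes estimator $$\widehat\Sigma^{GB}=\widehat\Sigma_0-k_0\widehat\Sigma_0(I_p+(1-k_0)S^{-1}X^\top X)^{-1},$$ which corresponds to $\psi_i=k_0/\{1+(1-k_0)f_i\}$, does not satisfy $\widehat\Delta(\widehat\Sigma^{GB},\widehat\Sigma_0)\le0$ when the $f_i$'s are close to $0$; that is, there is $\varepsilon>0$ such that $\widehat\Delta(\widehat\Sigma^{GB},\widehat\Sigma_0)>0$ whenever $\varepsilon>f_1>\cdots>f_p>0$.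
   Context: $X$ ($m\times p$) and $S$ ($p\times p$) are independent with $X\sim\mathcal N_{m\times p}(\Theta,I_m\otimes\Sigma)$ (independent normal rows with covariance $\Sigma$) and $S\sim\mathcal W_p(n,\Sigma)$ (Wishart), $m\ge p$. Let $Q$ be a $p\times p$ nonsingular matrix with $Q^\top SQ=I_p$, $Q^\top X^\top XQ=F=\mathrm{diag}(f_1,\dots,f_p)$, $f_1>\cdots>f_p>0$. Consider estimators $\widehat\Sigma^{SH}=\widehat\Sigma_0-n^{-1}(Q^\top)^{-1}\Psi(F)Q^{-1}$ with $\Psi(F)=\mathrm{diag}(\psi_1(F),\dots,\psi_p(F))$. The unbiased estimator of the risk difference between $\widehat\Sigma^{SH}$ and $\widehat\Sigma_0$ relative to the Stein loss $L_S(\widehat\Sigma,\Sigma)=\mathrm{tr}(\widehat\Sigma\Sigma^{-1})-\log|\widehat\Sigma\Sigma^{-1}|-p$ is $$\widehat\Delta(\widehat\Sigma^{SH},\widehat\Sigma_0)=\frac1n\sum_{i=1}^p\Big\{-d_i\psi_i+2f_i\frac{\partial\psi_i}{\partial f_i}+2\sum_{j>i}^p\frac{\psi_i-\psi_j}{f_i-f_j}f_j-n\log(1-\psi_i)\Big\},\qquad d_i=n-p+2i-1.$$ *)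

theory Defs
  imports "HOL-Analysis.Derivative"
    "Jordan_Normal_Form.Matrix"
    "Jordan_Normal_Form.Gauss_Jordan_Elimination"
begin

text \<open>
  Indices are shifted: the mathematical \<open>f\<^sub>1, \<dots>, f\<^sub>p\<close> and \<open>\<psi>\<^sub>1, \<dots>, \<psi>\<^sub>p\<close> are
  \<open>f 0, \<dots>, f (p - 1)\<close> and \<open>psi f 0, \<dots>, psi f (p - 1)\<close>. The values of \<open>f\<close> at indices \<open>\<ge> p\<close>
  carry no meaning.
\<close>

text \<open>Only used for nonsingular matrices; the value is unspecified for singular ones.\<close>

definition minv :: "real mat \<Rightarrow> real mat" where
  "minv A = the (mat_inverse A)"

definition ordered_roots :: "nat \<Rightarrow> (nat \<Rightarrow> real) \<Rightarrow> bool" where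
  "ordered_roots p f \<longleftrightarrow> (\<forall>i<p. 0 < f i) \<and> (\<forall>i j. i < j \<and> j < p \<longrightarrow> f j < f i)"

definition simult_diag ::
  "nat \<Rightarrow> nat \<Rightarrow> real mat \<Rightarrow> real mat \<Rightarrow> real mat \<Rightarrow> (nat \<Rightarrow> real) \<Rightarrow> bool" where
  "simult_diag m p S X Q f \<longleftrightarrow>
     S \<in> carrier_mat p p \<and> X \<in> carrier_mat m p \<and> Q \<in> carrier_mat p p \<and>
     invertible_mat Q \<and>
     transpose_mat Q * S * Q = 1\<^sub>m p \<and>
     transpose_mat Q * (transpose_mat X * X) * Q = mat_diag p f \<and>
     ordered_roots p f"

definition Sigma_0 :: "nat \<Rightarrow> real mat \<Rightarrow> real mat" where
  "Sigma_0 n S = (1 / real n) \<cdot>\<^sub>m S"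

definition Sigma_SH ::
  "nat \<Rightarrow> nat \<Rightarrow> ((nat \<Rightarrow> real) \<Rightarrow> nat \<Rightarrow> real) \<Rightarrow> real mat \<Rightarrow> real mat \<Rightarrow> (nat \<Rightarrow> real) \<Rightarrow> real mat" where
  "Sigma_SH p n psi S Q f =
     Sigma_0 n S - (1 / real n) \<cdot>\<^sub>m (minv (transpose_mat Q) * mat_diag p (psi f) * minv Q)"

definition corresponds_to ::
  "nat \<Rightarrow> nat \<Rightarrow> nat \<Rightarrow> (real mat \<Rightarrow> real mat \<Rightarrow> real mat) \<Rightarrow> ((nat \<Rightarrow> real) \<Rightarrow> nat \<Rightarrow> real) \<Rightarrow> bool" where
  "corresponds_to m p n est psi \<longleftrightarrow>
     (\<forall>S X Q f. simult_diag m p S X Q f \<longrightarrow> est S X = Sigma_SH p n psi S Q f)"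

text \<open>
  The unbiased estimator of the risk difference, relative to the Stein loss, between the estimator
  given by \<open>psi\<close> and \<open>Sigma_0\<close>. The constant \<open>d\<^sub>i = n - p + 2i - 1\<close> becomes
  \<open>n - p + 2(i + 1) - 1\<close> after the index shift.
\<close>

definition Delta_hat ::
  "nat \<Rightarrow> nat \<Rightarrow> ((nat \<Rightarrow> real) \<Rightarrow> nat \<Rightarrow> real) \<Rightarrow> (nat \<Rightarrow> real) \<Rightarrow> real" where
  "Delta_hat p n psi f = (1 / real n) * (\<Sum>i<p.
       - (real n - real p + 2 * real (i + 1) - 1) * psi f i
       + 2 * f i * deriv (\<lambda>t. psi (f(i := t)) i) (f i)
       + 2 * (\<Sum>j\<in>{i<..<p}. (psi f i - psi f j) / (f i - f j) * f j)
       - real n * ln (1 - psi f i))"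

definition Sigma_G2 :: "nat \<Rightarrow> nat \<Rightarrow> real \<Rightarrow> real \<Rightarrow> real mat \<Rightarrow> real mat \<Rightarrow> real mat" where
  "Sigma_G2 p n \<alpha> \<beta> S X =
     Sigma_0 n S - \<alpha> \<cdot>\<^sub>m (Sigma_0 n S * minv (1\<^sub>m p + \<beta> \<cdot>\<^sub>m (minv S * (transpose_mat X * X))))"

definition psi_G2 :: "real \<Rightarrow> real \<Rightarrow> (nat \<Rightarrow> real) \<Rightarrow> nat \<Rightarrow> real" where
  "psi_G2 \<alpha> \<beta> f i = \<alpha> / (1 + \<beta> * f i)"

definition k_0 :: "nat \<Rightarrow> nat \<Rightarrow> nat \<Rightarrow> real \<Rightarrow> real" where
  "k_0 m p n a = (a + real m + 2 * real p - real n) / (a + real m + 2 * real p)"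

definition Sigma_GB :: "nat \<Rightarrow> nat \<Rightarrow> nat \<Rightarrow> real \<Rightarrow> real mat \<Rightarrow> real mat \<Rightarrow> real mat" where
  "Sigma_GB m p n a S X =
     Sigma_0 n S - k_0 m p n a \<cdot>\<^sub>m
       (Sigma_0 n S * minv (1\<^sub>m p + (1 - k_0 m p n a) \<cdot>\<^sub>m (minv S * (transpose_mat X * X))))"

definition psi_GB :: "nat \<Rightarrow> nat \<Rightarrow> nat \<Rightarrow> real \<Rightarrow> (nat \<Rightarrow> real) \<Rightarrow> nat \<Rightarrow> real" where
  "psi_GB m p n a f i = k_0 m p n a / (1 + (1 - k_0 m p n a) * f i)"

end

theory Submission
  imports Defs "Jordan_Normal_Form.Determinant"
begin

text \<open>
  Everything happens in the limit where all roots \<open>f i\<close> tend to \<open>0\<close>. There every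
  \<open>\<psi>\<^sub>i = \<alpha> / (1 + \<beta> f\<^sub>i)\<close> tends to \<open>\<alpha>\<close>, while the derivative terms and the terms with difference
  quotients carry a factor \<open>f\<^sub>i\<close> or \<open>f\<^sub>j\<close> and vanish: for this \<open>\<psi>\<close> the difference quotient equals
  \<open>- \<alpha>\<beta> / ((1 + \<beta> f\<^sub>i)(1 + \<beta> f\<^sub>j))\<close> and so stays bounded even when \<open>f\<^sub>i\<close> and \<open>f\<^sub>j\<close> come close to
  each other. What remains of \<open>n\<close> times the estimated risk difference is
  \<open>- \<alpha> \<Sum>\<^sub>i d\<^sub>i - n p ln (1 - \<alpha>)\<close>, and since the weights \<open>d\<^sub>i\<close> add up to \<open>n p\<close>, the limit after division by \<open>n\<close> is
  \<open>p (- \<alpha> - ln (1 - \<alpha>))\<close>, which is positive by \<open>ln x < x - 1\<close> for \<open>x \<noteq> 1\<close>.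

  To have one \<open>\<epsilon>\<close> that works for all configurations of roots below it, the limit is taken in a
  lower bound that depends on \<open>\<epsilon>\<close> alone (\<open>Delta_hat_G2_lower_bound\<close>); positivity near \<open>0\<close>
  (\<open>Delta_hat_G2_pos_near_0\<close>) follows by continuity of that bound at \<open>0\<close>.

  The generalized Bayes estimator is the member \<open>\<alpha> = k\<^sub>0\<close>, \<open>\<beta> = 1 - k\<^sub>0\<close> of the same family, and
  the upper bound on \<open>c\<close> forces \<open>0 < k\<^sub>0 < 1\<close>; hence both parts rest on the same two facts.

  The matrix form corresponds to \<open>\<psi>\<close> (\<open>corresponds_to_G2\<close>) because \<open>Q\<close> diagonalizes everything in
  sight: \<open>S = Q\<^sup>-\<^sup>T Q\<^sup>-\<^sup>1\<close> and \<open>S\<^sup>-\<^sup>1 X\<^sup>T X = Q F Q\<^sup>-\<^sup>1\<close>.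
\<close>

section \<open>The matrix form of the estimators\<close>

lemma minv_unique:
  assumes A: "A \<in> carrier_mat p p" and B: "B \<in> carrier_mat p p" and AB: "A * B = 1\<^sub>m p"
  shows "minv A = B"
proof -
  have BA: "B * A = 1\<^sub>m p"
    using mat_mult_left_right_inverse[OF A B AB] .
  have "A \<in> Units (ring_mat TYPE(real) p ())"
    using A B AB BA by (auto simp: Units_def ring_mat_def)
  then obtain C where C: "mat_inverse A = Some C"
    using mat_inverse(1)[OF A, of "()"] by (cases "mat_inverse A") auto
  have CA: "C * A = 1\<^sub>m p" and Cc: "C \<in> carrier_mat p p"
    using mat_inverse(2)[OF A C] by auto
  have "C = C * (A * B)" using AB Cc by simp
  also have "\<dots> = (C * A) * B" using assoc_mult_mat[OF Cc A B] by simp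
  also have "\<dots> = B" using CA B by simp
  finally show ?thesis using C by (simp add: minv_def)
qed

lemma minv_invertible:
  assumes A: "A \<in> carrier_mat p p" and inv: "invertible_mat A"
  shows "minv A \<in> carrier_mat p p" and "A * minv A = 1\<^sub>m p" and "minv A * A = 1\<^sub>m p"
proof -
  obtain B where AB: "A * B = 1\<^sub>m p" and BA: "B * A = 1\<^sub>m (dim_row B)"
    using inv A by (auto simp: invertible_mat_def inverts_mat_def)
  have "dim_col B = p" using arg_cong[OF AB, of dim_col] by simp
  moreover have "dim_row B = p" using arg_cong[OF BA, of dim_col] A by simp
  ultimately have B: "B \<in> carrier_mat p p" by auto
  have "minv A = B" using minv_unique[OF A B AB] .
  then show "minv A \<in> carrier_mat p p" "A * minv A = 1\<^sub>m p" "minv A * A = 1\<^sub>m p"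
    using B AB BA by auto
qed

text \<open>
  With \<open>R\<close> the inverse of \<open>Q\<close>, this solves the two defining equations of \<open>Q\<close> for \<open>S\<close>
  and \<open>X\<^sup>T X\<close>.
\<close>

lemma congruence_inverse:
  assumes "A \<in> carrier_mat p p" "Q \<in> carrier_mat p p" "R \<in> carrier_mat p p"
    and QR: "Q * R = 1\<^sub>m p" and eq: "transpose_mat Q * A * Q = (D :: real mat)"
  shows "A = transpose_mat R * D * R"
proof -
  have "transpose_mat R * transpose_mat Q = 1\<^sub>m p"
    using QR assms(2,3) by (metis transpose_mult transpose_one)
  then have "A = (transpose_mat R * transpose_mat Q) * A * (Q * R)"
    using assms(1) QR by simp
  also have "\<dots> = transpose_mat R * D * R"
    using assms(1-3) by (simp flip: eq add: assoc_mult_mat[of _ p p _ p _ p])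
  finally show ?thesis .
qed

text \<open>
  With \<open>R = Q\<^sup>-\<^sup>1\<close> one gets \<open>S = R\<^sup>T R\<close> and
  \<open>(I + \<beta> S\<^sup>-\<^sup>1 X\<^sup>T X)\<^sup>-\<^sup>1 = Q (I + \<beta> F)\<^sup>-\<^sup>1 R\<close>, so the correction term
  \<open>\<alpha> S (I + \<beta> S\<^sup>-\<^sup>1 X\<^sup>T X)\<^sup>-\<^sup>1\<close> is \<open>R\<^sup>T (\<alpha> (I + \<beta> F)\<^sup>-\<^sup>1) R\<close>, whose middle
  factor is \<open>\<Psi>(F)\<close>.
\<close>

lemma corresponds_to_G2:
  assumes "0 \<le> \<beta>"
  shows "corresponds_to m p n (Sigma_G2 p n \<alpha> \<beta>) (psi_G2 \<alpha> \<beta>)"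
  unfolding corresponds_to_def
proof (intro allI impI)
  fix S X Q f
  assume "simult_diag m p S X Q f"
  then have S: "S \<in> carrier_mat p p" and X: "X \<in> carrier_mat m p" and Q: "Q \<in> carrier_mat p p"
    and invQ: "invertible_mat Q" and QSQ: "transpose_mat Q * S * Q = 1\<^sub>m p"
    and QXQ: "transpose_mat Q * (transpose_mat X * X) * Q = mat_diag p f"
    and f: "\<And>i. i < p \<Longrightarrow> 0 < f i"
    by (auto simp: simult_diag_def ordered_roots_def)
  note assoc = assoc_mult_mat[of _ p p _ p _ p]
  define R where "R = minv Q"
  have R: "R \<in> carrier_mat p p" and QR: "Q * R = 1\<^sub>m p" and RQ: "R * Q = 1\<^sub>m p"
    using minv_invertible[OF Q invQ] by (auto simp: R_def)
  have RtQt: "transpose_mat R * transpose_mat Q = 1\<^sub>m p"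
    and QtRt: "transpose_mat Q * transpose_mat R = 1\<^sub>m p"
    unfolding transpose_mult[OF Q R, symmetric] transpose_mult[OF R Q, symmetric] QR RQ by simp_all
  have minvQt: "minv (transpose_mat Q) = transpose_mat R"
    using minv_unique[of "transpose_mat Q" p "transpose_mat R"] Q R QtRt by simp
  have Seq: "S = transpose_mat R * R"
    using congruence_inverse[OF S Q R QR QSQ] R by simp
  have Weq: "transpose_mat X * X = transpose_mat R * mat_diag p f * R"
    using congruence_inverse[OF _ Q R QR QXQ] X by simp
  define F where "F = mat_diag p f"
  define D where "D = mat_diag p (\<lambda>i. 1 / (1 + \<beta> * f i))"
  have F: "F \<in> carrier_mat p p" and D: "D \<in> carrier_mat p p" by (auto simp: F_def D_def)
  have cancel: "R * (Q * M) = M" "Q * (R * M) = M"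
      "transpose_mat R * (transpose_mat Q * M) = M" "transpose_mat Q * (transpose_mat R * M) = M"
    if M: "M \<in> carrier_mat p p" for M
  proof -
    have cancel: "A * (B * M) = M"
      if "A \<in> carrier_mat p p" "B \<in> carrier_mat p p" "A * B = 1\<^sub>m p" for A B
      using assoc[OF that(1,2) M] that(3) M by simp
    show "R * (Q * M) = M" "Q * (R * M) = M"
      "transpose_mat R * (transpose_mat Q * M) = M" "transpose_mat Q * (transpose_mat R * M) = M"
      using Q R QR RQ RtQt QtRt by (simp_all add: cancel)
  qed
  have minvS: "minv S = Q * transpose_mat Q"
    by (rule minv_unique) (use Q R cancel QtRt RtQt in \<open>simp_all add: Seq assoc\<close>)
  have W: "minv S * (transpose_mat X * X) = Q * (F * R)"
    using Q R F by (simp add: minvS Weq assoc cancel flip: F_def)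
  have FD: "(1\<^sub>m p + \<beta> \<cdot>\<^sub>m F) * D = 1\<^sub>m p"
  proof -
    have "1\<^sub>m p + \<beta> \<cdot>\<^sub>m F = mat_diag p (\<lambda>i. 1 + \<beta> * f i)"
      by (rule eq_matI) (auto simp: F_def mat_diag_def)
    moreover have "1 + \<beta> * f i \<noteq> 0" if "i < p" for i
      using f[OF that] assms mult_nonneg_nonneg[of \<beta> "f i"] by linarith
    ultimately show ?thesis
      by (simp add: D_def) (rule eq_matI, auto simp: mat_diag_def)
  qed
  have IF: "1\<^sub>m p + \<beta> \<cdot>\<^sub>m F \<in> carrier_mat p p" using F by simp
  have "1\<^sub>m p + \<beta> \<cdot>\<^sub>m (Q * (F * R)) = Q * ((1\<^sub>m p + \<beta> \<cdot>\<^sub>m F) * R)"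
    using Q R F QR by (simp add: add_mult_distrib_mat[of _ p p] mult_add_distrib_mat[of _ p p]
        mult_smult_distrib[of _ p p _ p] mult_smult_assoc_mat[of _ p p _ p])
  moreover have "Q * (G * R) * (Q * (D * R)) = Q * ((G * D) * R)" if "G \<in> carrier_mat p p" for G
    using Q R D that by (simp add: assoc cancel)
  from this[of "1\<^sub>m p + \<beta> \<cdot>\<^sub>m F"]
  have "Q * ((1\<^sub>m p + \<beta> \<cdot>\<^sub>m F) * R) * (Q * (D * R)) = 1\<^sub>m p"
    unfolding FD using IF R QR by simp
  ultimately have minvI: "minv (1\<^sub>m p + \<beta> \<cdot>\<^sub>m (Q * (F * R))) = Q * (D * R)"
    using minv_unique[of _ p "Q * (D * R)"] Q R D IF by simp
  have psiD: "mat_diag p (psi_G2 \<alpha> \<beta> f) = \<alpha> \<cdot>\<^sub>m D"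
    by (rule eq_matI) (auto simp: D_def mat_diag_def psi_G2_def)
  have "Sigma_0 n S * (Q * (D * R)) = (1 / real n) \<cdot>\<^sub>m (transpose_mat R * (D * R))"
    using Q R D by (simp add: Sigma_0_def Seq mult_smult_assoc_mat[of _ p p _ p] assoc cancel)
  moreover have "transpose_mat R * (\<alpha> \<cdot>\<^sub>m D) * R = \<alpha> \<cdot>\<^sub>m (transpose_mat R * (D * R))"
    using R D by (simp add: assoc mult_smult_distrib[of _ p p] mult_smult_assoc_mat[of _ p p])
  ultimately show "Sigma_G2 p n \<alpha> \<beta> S X = Sigma_SH p n (psi_G2 \<alpha> \<beta>) S Q f"
    unfolding Sigma_G2_def Sigma_SH_def W minvI psiD minvQt R_def[symmetric]
    by (auto intro!: eq_matI simp: mult.commute)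
qed

section \<open>The risk difference near the origin\<close>

lemma deriv_psi_G2:
  assumes "0 \<le> \<beta>" "0 < f i"
  shows "deriv (\<lambda>t. psi_G2 \<alpha> \<beta> (f(i := t)) i) (f i) = - \<alpha> * \<beta> / (1 + \<beta> * f i)^2"
proof -
  have "1 + \<beta> * f i \<noteq> 0"
    using assms mult_nonneg_nonneg[of \<beta> "f i"] by linarith
  then show ?thesis
    unfolding psi_G2_def fun_upd_same
    by (intro DERIV_imp_deriv) (auto intro!: derivative_eq_intros simp: power2_eq_square)
qed

text \<open>
  The gap \<open>f i - f j\<close> cancels. The quotient therefore stays bounded however close two roots
  are, which is why a bound on the size of the roots suffices.
\<close>

lemma psi_G2_difference_quotient:
  assumes "0 \<le> \<beta>" "0 < f i" "0 < f j" "f i \<noteq> f j"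
  shows "(psi_G2 \<alpha> \<beta> f i - psi_G2 \<alpha> \<beta> f j) / (f i - f j)
         = - \<alpha> * \<beta> / ((1 + \<beta> * f i) * (1 + \<beta> * f j))"
proof -
  have "1 + \<beta> * f i \<noteq> 0" "1 + \<beta> * f j \<noteq> 0"
    using assms mult_nonneg_nonneg[of \<beta> "f i"] mult_nonneg_nonneg[of \<beta> "f j"] by linarith+
  then have "psi_G2 \<alpha> \<beta> f i - psi_G2 \<alpha> \<beta> f j
      = - \<alpha> * \<beta> / ((1 + \<beta> * f i) * (1 + \<beta> * f j)) * (f i - f j)"
    unfolding psi_G2_def by (simp add: divide_simps) (simp add: algebra_simps)
  then show ?thesis using assms(4) by simp
qed

text \<open>
  The weights average to \<open>n\<close>, exactly the coefficient of the logarithm; this is what reduces the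
  limit at the origin to a multiple of \<open>- \<alpha> - ln (1 - \<alpha>)\<close>.
\<close>

lemma sum_stein_weights:
  "(\<Sum>i<p. real n - real p + 2 * real (i + 1) - 1) = real n * real p"
proof -
  have "(\<Sum>i<q. x + 2 * real (i + 1) - 1) = real q * (x + real q)" for q x
    by (induction q) (auto simp: algebra_simps)
  from this[of "real n - real p" p] show ?thesis by (simp add: algebra_simps)
qed

text \<open>
  Each summand is bounded below term by term: \<open>- d\<^sub>i \<psi>\<^sub>i\<close> by \<open>\<psi>\<^sub>i \<le> \<alpha>\<close> (here \<open>d\<^sub>i \<ge> 0\<close> needs
  \<open>p \<le> n\<close>), the logarithm by \<open>\<psi>\<^sub>i \<ge> \<alpha> / (1 + \<beta> \<epsilon>)\<close>, and the derivative together with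
  the at most \<open>p\<close> difference quotients by \<open>p + 1\<close> times \<open>- 2 \<alpha> \<beta> \<epsilon>\<close>.
\<close>

lemma Delta_hat_G2_lower_bound:
  assumes "p \<le> n" and \<alpha>: "0 < \<alpha>" "\<alpha> < 1" and \<beta>: "0 \<le> \<beta>"
    and ord: "ordered_roots p f" and small: "\<And>i. i < p \<Longrightarrow> f i < \<epsilon>"
  shows "(real p / real n) *
           (- real n * \<alpha> - 2 * (real p + 1) * (\<alpha> * \<beta> * \<epsilon>) - real n * ln (1 - \<alpha> / (1 + \<beta> * \<epsilon>)))
         \<le> Delta_hat p n (psi_G2 \<alpha> \<beta>) f"
proof -
  define d where "d i = real n - real p + 2 * real (i + 1) - 1" for i
  have pos: "0 < f i" if "i < p" for i using ord that by (auto simp: ordered_roots_def)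
  \<comment> \<open>Covers the derivative, with \<open>u = (1 + \<beta> f\<^sub>i)\<^sup>2\<close>, and the difference quotients, with
      \<open>u = (1 + \<beta> f\<^sub>i) (1 + \<beta> f\<^sub>j)\<close>.\<close>
  have shrink: "- (\<alpha> * \<beta> * \<epsilon>) \<le> - \<alpha> * \<beta> / u * f i" if "i < p" "1 \<le> u" for i u
  proof -
    have "\<alpha> * \<beta> * f i / u \<le> \<alpha> * \<beta> * f i / 1"
      using that pos[OF that(1)] \<alpha> \<beta> by (intro divide_left_mono) auto
    also have "\<dots> \<le> \<alpha> * \<beta> * \<epsilon>"
      using small[OF that(1)] \<alpha> \<beta> by (simp add: mult_left_mono)
    finally show ?thesis by simp
  qed
  have one: "- d i * \<alpha> - 2 * (real p + 1) * (\<alpha> * \<beta> * \<epsilon>) - real n * ln (1 - \<alpha> / (1 + \<beta> * \<epsilon>))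
      \<le> - d i * psi_G2 \<alpha> \<beta> f i
        + 2 * f i * deriv (\<lambda>t. psi_G2 \<alpha> \<beta> (f(i := t)) i) (f i)
        + 2 * (\<Sum>j\<in>{i<..<p}. (psi_G2 \<alpha> \<beta> f i - psi_G2 \<alpha> \<beta> f j) / (f i - f j) * f j)
        - real n * ln (1 - psi_G2 \<alpha> \<beta> f i)" if i: "i < p" for i
  proof -
    have fi: "0 < f i" "f i < \<epsilon>" using pos[OF i] small[OF i] by auto
    have ge1: "1 \<le> 1 + \<beta> * f j" if "j < p" for j using pos[OF that] \<beta> by simp
    have le_eps: "1 + \<beta> * f i \<le> 1 + \<beta> * \<epsilon>" using fi \<beta> by (simp add: mult_left_mono)
    have "psi_G2 \<alpha> \<beta> f i \<le> \<alpha> / 1"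
      unfolding psi_G2_def using ge1[OF i] \<alpha> by (intro divide_left_mono) auto
    then have psi_le: "psi_G2 \<alpha> \<beta> f i \<le> \<alpha>" by simp
    have psi_ge: "\<alpha> / (1 + \<beta> * \<epsilon>) \<le> psi_G2 \<alpha> \<beta> f i"
      unfolding psi_G2_def using le_eps ge1[OF i] \<alpha> by (intro divide_left_mono mult_pos_pos) auto
    have "0 \<le> d i" using assms(1) by (simp add: d_def)
    then have t1: "- d i * \<alpha> \<le> - d i * psi_G2 \<alpha> \<beta> f i"
      using psi_le by (simp add: mult_left_mono)
    have t2: "- 2 * (\<alpha> * \<beta> * \<epsilon>) \<le> 2 * f i * deriv (\<lambda>t. psi_G2 \<alpha> \<beta> (f(i := t)) i) (f i)"
    proof -
      have "2 * - (\<alpha> * \<beta> * \<epsilon>) \<le> 2 * (- \<alpha> * \<beta> / (1 + \<beta> * f i)^2 * f i)"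
        using shrink[OF i one_le_power[OF ge1[OF i]]] by (rule mult_left_mono) simp
      then show ?thesis
        unfolding deriv_psi_G2[of \<beta> f i, OF \<beta> fi(1)] by (simp add: mult_ac)
    qed
    have "- (\<alpha> * \<beta> * \<epsilon>) \<le> (psi_G2 \<alpha> \<beta> f i - psi_G2 \<alpha> \<beta> f j) / (f i - f j) * f j"
      if "j \<in> {i<..<p}" for j
    proof -
      have j: "j < p" "f j < f i" using that ord by (auto simp: ordered_roots_def)
      have "1 \<le> (1 + \<beta> * f i) * (1 + \<beta> * f j)"
        using mult_mono[OF ge1[OF i] ge1[OF j(1)]] ge1[OF i] by simp
      from shrink[OF j(1) this] show ?thesis
        using psi_G2_difference_quotient[of \<beta> f i j, OF \<beta> fi(1) pos[OF j(1)]] j(2) by simp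
    qed
    then have "(\<Sum>j\<in>{i<..<p}. - (\<alpha> * \<beta> * \<epsilon>)) \<le>
        (\<Sum>j\<in>{i<..<p}. (psi_G2 \<alpha> \<beta> f i - psi_G2 \<alpha> \<beta> f j) / (f i - f j) * f j)"
      by (rule sum_mono)
    moreover have "- real p * (\<alpha> * \<beta> * \<epsilon>) \<le> (\<Sum>j\<in>{i<..<p}. - (\<alpha> * \<beta> * \<epsilon>))"
      using fi \<alpha> \<beta> by (simp add: mult_right_mono)
    ultimately have t3: "- 2 * real p * (\<alpha> * \<beta> * \<epsilon>) \<le>
        2 * (\<Sum>j\<in>{i<..<p}. (psi_G2 \<alpha> \<beta> f i - psi_G2 \<alpha> \<beta> f j) / (f i - f j) * f j)"
      by linarith
    have "ln (1 - psi_G2 \<alpha> \<beta> f i) \<le> ln (1 - \<alpha> / (1 + \<beta> * \<epsilon>))"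
      using psi_ge psi_le \<alpha> by simp
    then have t4: "- real n * ln (1 - \<alpha> / (1 + \<beta> * \<epsilon>)) \<le> - real n * ln (1 - psi_G2 \<alpha> \<beta> f i)"
      by (simp add: mult_left_mono)
    show ?thesis using t1 t2 t3 t4 by (simp add: algebra_simps)
  qed
  have "(\<Sum>i<p. - d i * \<alpha> - 2 * (real p + 1) * (\<alpha> * \<beta> * \<epsilon>) - real n * ln (1 - \<alpha> / (1 + \<beta> * \<epsilon>)))
      = - (\<Sum>i<p. d i) * \<alpha> + real p * (- 2 * (real p + 1) * (\<alpha> * \<beta> * \<epsilon>) - real n * ln (1 - \<alpha> / (1 + \<beta> * \<epsilon>)))"
    by (simp add: sum_subtractf sum_negf sum_distrib_left algebra_simps)
  also have "\<dots> = real p *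
      (- real n * \<alpha> - 2 * (real p + 1) * (\<alpha> * \<beta> * \<epsilon>) - real n * ln (1 - \<alpha> / (1 + \<beta> * \<epsilon>)))"
    unfolding d_def sum_stein_weights by (simp add: algebra_simps)
  finally have total: "real p *
      (- real n * \<alpha> - 2 * (real p + 1) * (\<alpha> * \<beta> * \<epsilon>) - real n * ln (1 - \<alpha> / (1 + \<beta> * \<epsilon>)))
      = (\<Sum>i<p. - d i * \<alpha> - 2 * (real p + 1) * (\<alpha> * \<beta> * \<epsilon>) - real n * ln (1 - \<alpha> / (1 + \<beta> * \<epsilon>)))" ..
  have "1 / real n * (real p *
      (- real n * \<alpha> - 2 * (real p + 1) * (\<alpha> * \<beta> * \<epsilon>) - real n * ln (1 - \<alpha> / (1 + \<beta> * \<epsilon>))))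
      \<le> Delta_hat p n (psi_G2 \<alpha> \<beta>) f"
    unfolding Delta_hat_def total d_def[symmetric]
    by (intro mult_left_mono sum_mono one) auto
  then show ?thesis by simp
qed

text \<open>At \<open>\<epsilon> = 0\<close> the preceding bound is \<open>p (- \<alpha> - ln (1 - \<alpha>)) > 0\<close>.\<close>

lemma Delta_hat_G2_pos_near_0:
  assumes "1 \<le> p" "p \<le> n" and \<alpha>: "0 < \<alpha>" "\<alpha> < 1" and \<beta>: "0 \<le> \<beta>"
  shows "\<exists>\<epsilon>>0. \<forall>f. ordered_roots p f \<and> (\<forall>i<p. f i < \<epsilon>) \<longrightarrow> 0 < Delta_hat p n (psi_G2 \<alpha> \<beta>) f"
proof -
  define g where "g \<epsilon> = - real n * \<alpha> - 2 * (real p + 1) * (\<alpha> * \<beta> * \<epsilon>)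
    - real n * ln (1 - \<alpha> / (1 + \<beta> * \<epsilon>))" for \<epsilon>
  have "(g \<longlongrightarrow> g 0) (at_right 0)"
    unfolding g_def using \<alpha> by (auto intro!: tendsto_eq_intros)
  moreover have "0 < g 0"
  proof -
    have "ln (1 - \<alpha>) < - \<alpha>"
      using \<alpha> ln_le_minus_one[of "1 - \<alpha>"] ln_eq_minus_one[of "1 - \<alpha>"] by force
    then have "0 < real n * (- \<alpha> - ln (1 - \<alpha>))"
      using assms(1,2) by (intro mult_pos_pos) auto
    then show ?thesis by (simp add: g_def right_diff_distrib)
  qed
  ultimately have "\<forall>\<^sub>F \<epsilon> in at_right 0. 0 < g \<epsilon>"
    by (rule order_tendstoD)
  then have "\<forall>\<^sub>F \<epsilon> in at_right 0. 0 < g \<epsilon> \<and> 0 < \<epsilon>"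
    using eventually_at_right_less[of 0] by (rule eventually_conj)
  then obtain \<epsilon> where \<epsilon>: "0 < g \<epsilon>" "0 < \<epsilon>"
    using eventually_happens'[OF trivial_limit_at_right_real] by blast
  have "0 < Delta_hat p n (psi_G2 \<alpha> \<beta>) f"
    if "ordered_roots p f" "\<forall>i<p. f i < \<epsilon>" for f
  proof -
    have "0 < real p / real n * g \<epsilon>" using \<epsilon> assms(1,2) by simp
    also have "\<dots> \<le> Delta_hat p n (psi_G2 \<alpha> \<beta>) f"
      unfolding g_def using Delta_hat_G2_lower_bound[OF assms(2) \<alpha> \<beta> that(1)] that(2) by auto
    finally show ?thesis .
  qed
  then show ?thesis using \<epsilon>(2) by blast
qed

lemma ordered_roots_below:
  assumes "0 < \<epsilon>"
  shows "\<exists>f. ordered_roots p f \<and> (\<forall>i<p. f i < \<epsilon>)"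
  using assms
  by (intro exI[of _ "\<lambda>i. \<epsilon> / (real i + 2)"])
     (auto simp: ordered_roots_def field_simps intro!: add_pos_nonneg)

theorem proposition4p1:
  fixes m p n :: nat
  assumes "1 \<le> p" and "p \<le> m" and "p \<le> n"
  shows
    "(\<forall>\<alpha> \<beta>. 0 < \<alpha> \<and> \<alpha> < 1 \<and> 0 \<le> \<beta> \<longrightarrow>
        corresponds_to m p n (Sigma_G2 p n \<alpha> \<beta>) (psi_G2 \<alpha> \<beta>))
     \<and> \<not> (\<exists>\<alpha> \<beta>. 0 < \<alpha> \<and> \<alpha> < 1 \<and> 0 \<le> \<beta> \<and>
          (\<forall>f. ordered_roots p f \<longrightarrow> Delta_hat p n (psi_G2 \<alpha> \<beta>) f \<le> 0))
     \<and> (\<forall>(a::real) (c::real).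
          c = real n - real m - 1 \<and> real p - real m - 2 < c \<and> c < a + real p \<longrightarrow>
            corresponds_to m p n (Sigma_GB m p n a) (psi_GB m p n a) \<and>
            (\<exists>\<epsilon>>0. \<forall>f. ordered_roots p f \<and> (\<forall>i<p. f i < \<epsilon>) \<longrightarrow>
               0 < Delta_hat p n (psi_GB m p n a) f))"
proof (intro conjI allI impI)
  show "corresponds_to m p n (Sigma_G2 p n \<alpha> \<beta>) (psi_G2 \<alpha> \<beta>)"
    if "0 < \<alpha> \<and> \<alpha> < 1 \<and> 0 \<le> \<beta>" for \<alpha> \<beta>
    using corresponds_to_G2 that by blast
next
  show "\<not> (\<exists>\<alpha> \<beta>. 0 < \<alpha> \<and> \<alpha> < 1 \<and> 0 \<le> \<beta> \<and>
          (\<forall>f. ordered_roots p f \<longrightarrow> Delta_hat p n (psi_G2 \<alpha> \<beta>) f \<le> 0))"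
    using Delta_hat_G2_pos_near_0[OF assms(1,3)] ordered_roots_below by (meson not_le)
next
  fix a c :: real
  assume "c = real n - real m - 1 \<and> real p - real m - 2 < c \<and> c < a + real p"
  \<comment> \<open>Substituting for \<open>c\<close>, the upper bound on \<open>c\<close> says that the numerator of \<open>k\<^sub>0\<close> exceeds
      \<open>p - 1\<close>; the denominator is larger by \<open>n\<close>.\<close>
  then have num: "0 < a + real m + 2 * real p - real n"
    using assms(1) by linarith
  then have k: "0 < k_0 m p n a" "k_0 m p n a < 1"
    using assms(1,3) by (auto simp: k_0_def)
  have GB: "Sigma_GB m p n a = Sigma_G2 p n (k_0 m p n a) (1 - k_0 m p n a)"
    "psi_GB m p n a = psi_G2 (k_0 m p n a) (1 - k_0 m p n a)"
    by (auto simp: fun_eq_iff Sigma_GB_def Sigma_G2_def psi_GB_def psi_G2_def)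
  show "corresponds_to m p n (Sigma_GB m p n a) (psi_GB m p n a)"
    unfolding GB using corresponds_to_G2 k by simp
  show "\<exists>\<epsilon>>0. \<forall>f. ordered_roots p f \<and> (\<forall>i<p. f i < \<epsilon>) \<longrightarrow> 0 < Delta_hat p n (psi_GB m p n a) f"
    unfolding GB using Delta_hat_G2_pos_near_0[OF assms(1,3)] k by simp
qed

end
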